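(* Let $X\subset\mathbb R$ be a compact interval with non-empty interior, let $N\ge 2$ and $r\ge 0$ be integers. Then the metric space $\big(\mathcal{PC}^r_N(X),\operatorname{comp}^r\big)$ is a Baire space, i.e. every countable intersection of dense open subsets of $\mathcal{PC}^r_N(X)$ is dense in $\mathcal{PC}^r_N(X)$.
   Context: Write $X=[c_0,c_N]$. A piecewise $\mathcal C^r$ map with $N$ continuity pieces is a map $f:X\to X$ together with a set $\Delta_f=\{c_1^f<\dots<c_{N-1}^f\}\subset \operatorname{int}(X)$ such that, with $X_1(f)=[c_0,c_1^f)$, $X_i(f)=(c_{i-1}^f,c_i^f)$ for $1<i<N$, $X_N(f)=(c_{N-1}^f,c_N]$ (the continuity pieces of $f$; $c_0^f:=c_0$, $c_N^f:=c_N$), $f$ is of class $\mathcal C^r$ on each $X_i(f)$ and, for every $0\le j\le r$, the derivative $f^{(j)}$ (with $f^{(0)}=f$) is uniformly continuous on each $X_i(f)$. (The points of $\Delta_f$ may be continuity points of $f$.) For $0\le j\le r$, $f_i^{(j)}:\overline{X_i(f)}\to\mathbb R$ denotes the unique continuous extension of $f^{(j)}|_{X_i(f)}$, and $f_i:=f_i^{(0)}$. Two such maps are identified when $\Delta_f=\Delta_g$ and $f=g$ on $X\setminus\Delta_f$; $\mathcal{PC}^r_N(X)$ is the set of equivalence classes, and a class is denoted by any of its representatives. For $f,g\in\mathcal{PC}^r_N(X)$ let $\xi(f,g;\cdot):X\to X$ be the increasing piecewise linear homeomorphism $$\xi(f,g;x)=\frac{c_i^g-c_{i-1}^g}{c_i^f-c_{i-1}^f}(x-c_i^f)+c_i^g,\qquad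 x\in\overline{X_i(f)},\ 1\le i\le N,$$ which maps $\overline{X_i(f)}$ onto $\overline{X_i(g)}$. The metric is $$\operatorname{comp}^r(f,g)=\sum_{i=1}^{N-1}|c_i^f-c_i^g|+\sum_{i=1}^N\sum_{j=0}^r\max_{x\in\overline{X_i(f)}}\big|f_i^{(j)}(x)-g_i^{(j)}(\xi(f,g;x))\big|.$$ *)

theory Defs
  imports "HOL-Analysis.Analysis"
begin

text \<open>
  Throughout, \<open>X = {a..b}\<close>, so \<open>a = c\<^sub>0\<close> and \<open>b = c\<^sub>N\<close>.  A piecewise map is a pair \<open>(f, D)\<close>
  of a function and its set \<open>D = \<Delta>\<^sub>f\<close> of separation points.
\<close>

type_synonym pw_map = "(real \<Rightarrow> real) \<times> real set"

definition bpt :: "real \<Rightarrow> real \<Rightarrow> real set \<Rightarrow> nat \<Rightarrow> real" where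
  "bpt a b D i = (a # sorted_list_of_set D @ [b]) ! i"

definition piece :: "real \<Rightarrow> real \<Rightarrow> nat \<Rightarrow> real set \<Rightarrow> nat \<Rightarrow> real set" where
  "piece a b N D i =
     (if i = 1 then {a..<bpt a b D 1}
      else if i = N then {bpt a b D (N - 1)<..b}
      else {bpt a b D (i - 1)<..<bpt a b D i})"

text \<open>
  Derivatives are taken within \<open>S\<close>, so that they are one-sided at an end point of \<open>X\<close>.
\<close>

primrec deriv_within :: "real set \<Rightarrow> nat \<Rightarrow> (real \<Rightarrow> real) \<Rightarrow> real \<Rightarrow> real" where
  "deriv_within S 0 f = f"
| "deriv_within S (Suc j) f = (\<lambda>x. vector_derivative (deriv_within S j f) (at x within S))"

definition class_C :: "nat \<Rightarrow> (real \<Rightarrow> real) \<Rightarrow> real set \<Rightarrow> bool" where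
  "class_C r f S \<longleftrightarrow>
     (\<forall>j<r. deriv_within S j f differentiable_on S) \<and>
     (\<forall>j\<le>r. continuous_on S (deriv_within S j f))"

definition pw_maps :: "real \<Rightarrow> real \<Rightarrow> nat \<Rightarrow> nat \<Rightarrow> pw_map set" where
  "pw_maps a b N r =
     {(f, D). f \<in> {a..b} \<rightarrow>\<^sub>E {a..b} \<and>
              finite D \<and> card D = N - 1 \<and> D \<subseteq> interior {a..b} \<and>
              (\<forall>i\<in>{1..N}. class_C r f (piece a b N D i) \<and>
                 (\<forall>j\<le>r. uniformly_continuous_on (piece a b N D i)
                          (deriv_within (piece a b N D i) j f)))}"

definition pw_rel :: "real \<Rightarrow> real \<Rightarrow> nat \<Rightarrow> nat \<Rightarrow> (pw_map \<times> pw_map) set" where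
  "pw_rel a b N r =
     {((f, D), (g, E)). (f, D) \<in> pw_maps a b N r \<and> (g, E) \<in> pw_maps a b N r \<and>
                        D = E \<and> (\<forall>x\<in>{a..b} - D. f x = g x)}"

definition PC :: "real \<Rightarrow> real \<Rightarrow> nat \<Rightarrow> nat \<Rightarrow> pw_map set set" where
  "PC a b N r = pw_maps a b N r // pw_rel a b N r"

text \<open>
  The continuous extension \<open>f\<^sub>i\<^sup>(\<^sup>j\<^sup>)\<close>.  It is made \<open>extensional\<close>, i.e. \<open>undefined\<close> off the closure,
  to be unique as a HOL function.
\<close>

definition ext_deriv ::
    "real \<Rightarrow> real \<Rightarrow> nat \<Rightarrow> pw_map \<Rightarrow> nat \<Rightarrow> nat \<Rightarrow> real \<Rightarrow> real" where
  "ext_deriv a b N p i j =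
     (let S = piece a b N (snd p) i in
      THE h. h \<in> extensional (closure S) \<and> continuous_on (closure S) h \<and>
             (\<forall>x\<in>S. h x = deriv_within S j (fst p) x))"

text \<open>
  At an interior separation point of \<open>D\<close> the two adjacent affine formulas agree; \<open>LEAST\<close> selects
  the one coming from the left (see \<open>xi_eq\<close> below).
\<close>

definition xi :: "real \<Rightarrow> real \<Rightarrow> real set \<Rightarrow> real set \<Rightarrow> real \<Rightarrow> real" where
  "xi a b D E x =
     (let i = (LEAST i. 1 \<le> i \<and> x \<le> bpt a b D i) in
      (bpt a b E i - bpt a b E (i - 1)) / (bpt a b D i - bpt a b D (i - 1)) * (x - bpt a b D i)
        + bpt a b E i)"

text \<open>
  The maximum of a continuous function over the compact set \<open>closure X\<^sub>i(f)\<close> is written as a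
  supremum.
\<close>

definition comp_rep :: "real \<Rightarrow> real \<Rightarrow> nat \<Rightarrow> nat \<Rightarrow> pw_map \<Rightarrow> pw_map \<Rightarrow> real" where
  "comp_rep a b N r p q =
     (\<Sum>i=1..N-1. \<bar>bpt a b (snd p) i - bpt a b (snd q) i\<bar>) +
     (\<Sum>i=1..N. \<Sum>j=0..r.
        SUP x\<in>closure (piece a b N (snd p) i).
          \<bar>ext_deriv a b N p i j x - ext_deriv a b N q i j (xi a b (snd p) (snd q) x)\<bar>)"

text \<open>
  The metric on classes, via arbitrary representatives (see \<open>comp_dist_eq\<close> below).  The value 0
  outside \<open>PC\<close> is needed since \<open>Metric_space\<close> demands nonnegativity and symmetry on the whole type.
\<close>

definition comp_dist ::
    "real \<Rightarrow> real \<Rightarrow> nat \<Rightarrow> nat \<Rightarrow> pw_map set \<Rightarrow> pw_map set \<Rightarrow> real" where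
  "comp_dist a b N r F G =
     (if F \<in> PC a b N r \<and> G \<in> PC a b N r
      then comp_rep a b N r (SOME p. p \<in> F) (SOME q. q \<in> G) else 0)"

definition Baire_space :: "'a topology \<Rightarrow> bool" where
  "Baire_space T \<longleftrightarrow>
     (\<forall>\<U>. countable \<U> \<and> (\<forall>U\<in>\<U>. openin T U \<and> T closure_of U = topspace T)
        \<longrightarrow> T closure_of (topspace T \<inter> \<Inter>\<U>) = topspace T)"

lemma bpt_strict_mono:
  assumes "finite D" "card D = N - 1" "2 \<le> N" "D \<subseteq> interior {a..b}" "i < j" "j \<le> N"
  shows "bpt a b D i < bpt a b D j"
proof -
  have "sorted_wrt (<) (a # sorted_list_of_set D @ [b])"
  proof -
    have "D \<noteq> {}" using assms(2,3) by auto
    moreover have lim: "a < x \<and> x < b" if "x \<in> D" for x using that assms(4) by auto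
    ultimately have "a < b" by fastforce
    then show ?thesis using lim assms(1) by (simp add: sorted_wrt_append)
  qed
  moreover have "length (a # sorted_list_of_set D @ [b]) = Suc N"
    using assms(2,3) by simp
  ultimately show ?thesis
    unfolding bpt_def using assms(5,6) by (metis le_imp_less_Suc sorted_wrt_iff_nth_less)
qed

lemma bpt_0: "bpt a b D 0 = a"
  by (simp add: bpt_def)

lemma bpt_N: "card D = N - 1 \<Longrightarrow> 2 \<le> N \<Longrightarrow> bpt a b D N = b"
  by (simp add: bpt_def nth_append nth_Cons split: nat.split)

lemma closure_piece:
  assumes "finite D" "card D = N - 1" "2 \<le> N" "D \<subseteq> interior {a..b}" "i \<in> {1..N}"
  shows "closure (piece a b N D i) = {bpt a b D (i - 1)..bpt a b D i}"
proof -
  have "bpt a b D (i - 1) < bpt a b D i"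
    using assms by (intro bpt_strict_mono) auto
  then show ?thesis
    using bpt_0[of a b D] bpt_N[OF assms(2,3), of a b] assms(3) by (auto simp: piece_def)
qed

lemma xi_eq:
  assumes D: "finite D" "card D = N - 1" "2 \<le> N" "D \<subseteq> interior {a..b}"
    and i: "i \<in> {1..N}" and x: "x \<in> closure (piece a b N D i)"
  shows "xi a b D E x =
     (bpt a b E i - bpt a b E (i - 1)) / (bpt a b D i - bpt a b D (i - 1)) * (x - bpt a b D i)
        + bpt a b E i"
proof -
  define c where "c = bpt a b D"
  have mono: "c k < c l" if "k < l" "l \<le> N" for k l
    unfolding c_def using D that by (rule bpt_strict_mono)
  have x: "c (i - 1) \<le> x" "x \<le> c i"
    using x closure_piece[OF D i] by (auto simp: c_def)
  show ?thesis
  proof (cases "x = c (i - 1) \<and> i \<noteq> 1")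
    case True
    have "(LEAST k. 1 \<le> k \<and> x \<le> c k) = i - 1"
    proof (rule Least_equality)
      fix k assume k: "1 \<le> k \<and> x \<le> c k"
      then show "i - 1 \<le> k"
        using mono[of k "i - 1"] True i by (cases "k < i - 1") fastforce+
    qed (use True i in auto)
    moreover have "c (i - 1) < c i"
      using mono i by auto
    ultimately show ?thesis
      using True by (simp add: xi_def Let_def c_def divide_simps) (simp add: algebra_simps)
  next
    case False
    have "(LEAST k. 1 \<le> k \<and> x \<le> c k) = i"
    proof (rule Least_equality)
      fix k assume k: "1 \<le> k \<and> x \<le> c k"
      show "i \<le> k"
      proof (rule ccontr)
        assume "\<not> i \<le> k"
        then have "c k \<le> c (i - 1)"
          using mono[of k "i - 1"] i by (cases "k = i - 1") fastforce+
        then show False using False x k \<open>\<not> i \<le> k\<close> by auto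
      qed
    qed (use x i in auto)
    then show ?thesis by (simp add: xi_def Let_def c_def)
  qed
qed

lemma deriv_within_cong:
  assumes "\<And>x. x \<in> S \<Longrightarrow> f x = g x" "x \<in> S"
  shows "deriv_within S j f x = deriv_within S j g x"
  using assms(2)
proof (induction j arbitrary: x)
  case (Suc j)
  have "(deriv_within S j f has_vector_derivative d) (at x within S) \<longleftrightarrow>
        (deriv_within S j g has_vector_derivative d) (at x within S)" for d
    using Suc by (metis has_vector_derivative_transform)
  then show ?case by (simp add: vector_derivative_def)
qed (use assms in simp)

lemma piece_avoids:
  assumes D: "finite D" "card D = N - 1" "2 \<le> N" "D \<subseteq> interior {a..b}"
    and i: "i \<in> {1..N}"
  shows "piece a b N D i \<subseteq> {a..b} - D"
proof -
  define c where "c = bpt a b D"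
  have mono: "c k < c l" if "k < l" "l \<le> N" for k l
    unfolding c_def using D that by (rule bpt_strict_mono)
  have mono': "c k \<le> c l" if "k \<le> l" "l \<le> N" for k l
    using mono[of k l] that by (cases "k = l") auto
  have c0N: "c 0 = a" "c N = b"
    using bpt_0 bpt_N[OF D(2,3)] by (auto simp: c_def)
  have D_eq: "\<exists>k. 1 \<le> k \<and> k < N \<and> x = c k" if "x \<in> D" for x
  proof -
    from that D(1) have "x \<in> set (sorted_list_of_set D)" by simp
    then obtain k where "k < card D" "x = sorted_list_of_set D ! k"
      by (metis in_set_conv_nth length_sorted_list_of_set)
    then show ?thesis
      using D by (intro exI[of _ "Suc k"]) (auto simp: c_def bpt_def nth_append)
  qed
  have P: "piece a b N D i =
      (if i = 1 then {c 0..<c 1} else if i = N then {c (N - 1)<..c N} else {c (i - 1)<..<c i})"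
    using c0N by (simp add: piece_def c_def)
  have sub: "piece a b N D i \<subseteq> {c (i - 1)..c i}"
    by (auto simp: P)
  have "c 0 \<le> c (i - 1)" "c i \<le> c N"
    using mono'[of 0 "i - 1"] mono'[of i N] i by (auto simp: le_diff_conv)
  then have "piece a b N D i \<subseteq> {a..b}"
    using sub c0N by fastforce
  moreover have False if xP: "x \<in> piece a b N D i" and xD: "x \<in> D" for x
  proof -
    obtain k where k: "1 \<le> k" "k < N" "x = c k" using D_eq xD by blast
    show False
    proof (cases "k < i")
      case True
      then have "c k \<le> c (i - 1)" using mono'[of k "i - 1"] i by auto
      then show False using xP k True i by (auto simp: P split: if_splits)
    next
      case False
      then have "c i \<le> c k" using mono'[of i k] k by auto
      then show False using xP k False i by (auto simp: P split: if_splits)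
    qed
  qed
  ultimately show ?thesis by blast
qed

lemma equiv_pw_rel: "equiv (pw_maps a b N r) (pw_rel a b N r)"
  by (rule equivI) (auto simp: pw_rel_def refl_on_def sym_def trans_def)

lemma ext_deriv_cong:
  assumes "2 \<le> N" "(p, q) \<in> pw_rel a b N r" "i \<in> {1..N}"
  shows "ext_deriv a b N p i j = ext_deriv a b N q i j"
proof -
  obtain f g D where pq: "p = (f, D)" "q = (g, D)" and m: "(f, D) \<in> pw_maps a b N r"
    and eq: "\<And>x. x \<in> {a..b} - D \<Longrightarrow> f x = g x"
    using assms(2) by (auto simp: pw_rel_def)
  have "piece a b N D i \<subseteq> {a..b} - D"
    using m assms(1,3) by (intro piece_avoids) (auto simp: pw_maps_def)
  then have "deriv_within (piece a b N D i) j f x = deriv_within (piece a b N D i) j g x"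
    if "x \<in> piece a b N D i" for x
    using that eq by (intro deriv_within_cong) auto
  then show ?thesis by (simp add: ext_deriv_def Let_def pq)
qed

lemma comp_dist_eq:
  assumes N: "2 \<le> N" and F: "F \<in> PC a b N r" "p \<in> F" and G: "G \<in> PC a b N r" "q \<in> G"
  shows "comp_dist a b N r F G = comp_rep a b N r p q"
proof -
  define p' q' where "p' = (SOME p. p \<in> F)" and "q' = (SOME q. q \<in> G)"
  have "p' \<in> F" "q' \<in> G"
    unfolding p'_def q'_def using F(2) G(2) by (auto intro: someI)
  then have rel: "(p', p) \<in> pw_rel a b N r" "(q', q) \<in> pw_rel a b N r"
    using F G quotient_eq_iff[OF equiv_pw_rel] unfolding PC_def by metis+
  then have "snd p' = snd p" "snd q' = snd q"
    by (auto simp: pw_rel_def)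
  moreover have "ext_deriv a b N p' i j = ext_deriv a b N p i j"
    "ext_deriv a b N q' i j = ext_deriv a b N q i j" if "i \<in> {1..N}" for i j
    using rel N that by (auto intro: ext_deriv_cong)
  ultimately have "comp_rep a b N r p' q' = comp_rep a b N r p q"
    unfolding comp_rep_def by (intro arg_cong2[of _ _ _ _ "(+)"] sum.cong) auto
  then show ?thesis
    using F(1) G(1) by (simp add: comp_dist_def p'_def q'_def)
qed

end

theory Submission
  imports Defs
begin

text \<open>
  The metric is not complete, since separation points may merge along a Cauchy sequence; this is
  the only obstruction.  Parametrising each continuity piece affinely by the unit interval turns
  the homeomorphisms \<open>\<xi>\<close> into the identity, so a Cauchy sequence whose pieces have lengths
  bounded away from 0 yields uniform limits of all the derivatives, which are again the
  derivatives of a piecewise map.  Adding \<open>\<bar>1 / \<phi>(f) - 1 / \<phi>(g)\<bar>\<close> to the metric, with \<open>\<phi>\<close> the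
  minimal length of a piece, keeps the topology and makes the space complete; Baire's theorem applies.
\<close>

section \<open>Complete metrizability and uniform limits\<close>

text \<open>This is the device by which an open subset of a complete space is remetrized. A Cauchy
  sequence for \<open>d'\<close> is Cauchy for \<open>d\<close> and keeps \<open>1 / \<phi>\<close>
  bounded on a tail, so \<open>\<phi>\<close> stays away from 0 there and \<open>lim\<close>
  applies.\<close>

lemma (in Metric_space) completely_metrizable_by_gauge:
  assumes cont: "continuous_map mtopology euclideanreal \<phi>"
    and pos: "\<And>x. x \<in> M \<Longrightarrow> 0 < \<phi> x"
    and lim: "\<And>\<sigma> \<delta>. MCauchy \<sigma> \<Longrightarrow> 0 < \<delta> \<Longrightarrow> (\<And>n. \<delta> \<le> \<phi> (\<sigma> n)) \<Longrightarrow>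
                 \<exists>x. limitin mtopology \<sigma> x sequentially"
  shows "completely_metrizable_space mtopology"
proof -
  define d' where "d' x y = d x y + \<bar>1 / \<phi> x - 1 / \<phi> y\<bar>" for x y
  have d_le: "d x y \<le> d' x y" for x y
    by (simp add: d'_def)
  interpret M': Metric_space M d'
  proof
    fix x y z assume "x \<in> M" "y \<in> M"
    then show "(d' x y = 0) = (x = y)"
      by (metis d'_def abs_ge_zero add_nonneg_eq_0_iff diff_self abs_zero nonneg zero)
    assume "z \<in> M"
    then show "d' x z \<le> d' x y + d' y z"
      using triangle[OF \<open>x \<in> M\<close> \<open>y \<in> M\<close> \<open>z \<in> M\<close>] by (simp add: d'_def)
  next
    fix x y show "0 \<le> d' x y" by (simp add: d'_def)
    show "d' x y = d' y x" by (simp add: d'_def commute abs_minus_commute)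
  qed
  have inv: "continuous_map mtopology euclideanreal (\<lambda>x. 1 / \<phi> x)"
    using cont pos by (intro continuous_map_real_divide continuous_map_const[THEN iffD2]) (auto, metis less_irrefl)
  have "openin mtopology U" if U: "openin M'.mtopology U" for U
    unfolding openin_subopen[of _ U]
  proof
    fix x assume "x \<in> U"
    then obtain r where r: "r > 0" "M'.mball x r \<subseteq> U" and x: "x \<in> M"
      using U by (meson M'.openin_mtopology subsetD)
    \<comment> \<open>Each of the two summands of \<open>d'\<close> gets half of the radius; the
      gauge part is open for \<open>d\<close> by continuity of \<open>1 / \<phi>\<close>.\<close>
    define W where "W = {y \<in> topspace mtopology. 1 / \<phi> y \<in> ball (1 / \<phi> x) (r/2)} \<inter> mball x (r/2)"
    have "openin mtopology W"
      unfolding W_def by (intro openin_Int openin_mball openin_continuous_map_preimage[OF inv]) (simp add: open_ball)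
    moreover have "x \<in> W" using x r by (simp add: W_def)
    moreover have "W \<subseteq> M'.mball x r"
      by (auto simp: W_def M'.in_mball d'_def dist_real_def)
    ultimately show "\<exists>T. openin mtopology T \<and> x \<in> T \<and> T \<subseteq> U"
      using r by blast
  qed
  moreover have "openin M'.mtopology U" if U: "openin mtopology U" for U
  proof -
    have "M'.mball x r \<subseteq> mball x r" for x r
      using le_less_trans[OF d_le] by fastforce
    then show ?thesis
      using U unfolding openin_mtopology M'.openin_mtopology by (meson order_trans)
  qed
  ultimately have top: "M'.mtopology = mtopology"
    by (metis topology_eq)
  have "M'.mcomplete"
    unfolding M'.mcomplete_def
  proof (intro allI impI)
    fix \<sigma> assume C: "M'.MCauchy \<sigma>"
    then have M: "range \<sigma> \<subseteq> M" by (simp add: M'.MCauchy_def)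
    have "MCauchy \<sigma>"
      using C d_le unfolding M'.MCauchy_def MCauchy_def by (meson le_less_trans)
    obtain N where N: "d' (\<sigma> N) (\<sigma> n) < 1" if "N \<le> n" for n
      using C unfolding M'.MCauchy_def by (meson le_refl zero_less_one)
    \<comment> \<open>From index \<open>N\<close> on, \<open>1 / \<phi>\<close> exceeds its value at
      \<open>\<sigma> N\<close> by less than 1, and \<open>\<delta>\<close> is the resulting lower
      bound for \<open>\<phi>\<close>. As it is only available on the tail, \<open>lim\<close> is
      applied to the shifted sequence.\<close>
    define \<delta> where "\<delta> = 1 / (1 / \<phi> (\<sigma> N) + 1)"
    have posn: "0 < \<phi> (\<sigma> n)" for n using M pos by auto
    have "\<delta> \<le> \<phi> ((\<sigma> \<circ> (+) N) n)" for n
    proof -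
      have "\<bar>1 / \<phi> (\<sigma> N) - 1 / \<phi> (\<sigma> (N + n))\<bar> < 1"
        using N[of "N + n"] nonneg[of "\<sigma> N" "\<sigma> (N + n)"] unfolding d'_def by linarith
      then have "1 / \<phi> (\<sigma> (N + n)) \<le> 1 / \<phi> (\<sigma> N) + 1" by linarith
      moreover have "0 < 1 / \<phi> (\<sigma> (N + n))" using posn by simp
      ultimately have "1 / (1 / \<phi> (\<sigma> N) + 1) \<le> 1 / (1 / \<phi> (\<sigma> (N + n)))"
        using frac_le by (metis zero_le_one order_refl)
      then show ?thesis by (simp add: \<delta>_def)
    qed
    moreover have "0 < \<delta>" using posn[of N] by (simp add: \<delta>_def add_pos_pos)
    ultimately obtain x where "limitin mtopology (\<sigma> \<circ> (+) N) x sequentially"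
      using lim MCauchy_imp_MCauchy_suffix[OF \<open>MCauchy \<sigma>\<close>, of N] by blast
    then have "limitin mtopology \<sigma> x sequentially"
      using limitin_sequentially_offset_rev[of mtopology \<sigma> N x] by (simp add: o_def add.commute)
    then show "\<exists>x. limitin M'.mtopology \<sigma> x sequentially"
      unfolding top by blast
  qed
  then show ?thesis
    by (metis M'.completely_metrizable_space_mtopology top)
qed

text \<open>What \<open>Baire_category\<close> leaves to check is the intersection with
  \<open>topspace T\<close>, which matters for an empty family and which closures ignore.\<close>

lemma completely_metrizable_imp_Baire_space:
  assumes "completely_metrizable_space T"
  shows "Baire_space T"
  unfolding Baire_space_def
proof (intro allI impI, elim conjE)
  fix \<U> assume \<U>: "countable \<U>" "\<forall>U\<in>\<U>. openin T U \<and> T closure_of U = topspace T"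
  show "T closure_of (topspace T \<inter> \<Inter>\<U>) = topspace T"
    using Baire_category[OF disjI1[OF assms] \<U>(1)] \<U>(2) closure_of_restrict[of T "\<Inter>\<U>"] by auto
qed

text \<open>Uniform convergence of the derivatives on a convex set allows limit and derivative to be
  exchanged; for the functions themselves pointwise convergence suffices.\<close>

lemma uniform_limit_has_vector_derivative:
  fixes g :: "nat \<Rightarrow> real \<Rightarrow> real"
  assumes S: "convex S"
    and der: "\<And>n t. t \<in> S \<Longrightarrow> (g n has_vector_derivative g' n t) (at t within S)"
    and g: "\<And>t. t \<in> S \<Longrightarrow> (\<lambda>n. g n t) \<longlonglongrightarrow> h t"
    and g': "uniform_limit S g' h' sequentially"
    and t: "t \<in> S"
  shows "(h has_vector_derivative h' t) (at t within S)"
proof -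
  have "\<exists>k. \<forall>x\<in>S. (\<lambda>n. g n x) \<longlonglongrightarrow> k x \<and> (k has_derivative (\<lambda>y. y *\<^sub>R h' x)) (at x within S)"
  proof (rule has_derivative_sequence[where f' = "\<lambda>n x y. y *\<^sub>R g' n x"])
    show "(g n has_derivative (\<lambda>y. y *\<^sub>R g' n x)) (at x within S)" if "x \<in> S" for n x
      using der[OF that] by (simp add: has_vector_derivative_def)
    fix e :: real assume "e > 0"
    then have "\<forall>\<^sub>F n in sequentially. \<forall>x\<in>S. dist (g' n x) (h' x) < e"
      using g' by (simp add: uniform_limit_iff)
    then show "\<forall>\<^sub>F n in sequentially. \<forall>x\<in>S. \<forall>y. norm (y *\<^sub>R g' n x - y *\<^sub>R h' x) \<le> e * norm y"
    proof (rule eventually_mono, intro ballI allI)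
      fix n x y assume "\<forall>x\<in>S. dist (g' n x) (h' x) < e" "x \<in> S"
      then have "\<bar>y\<bar> * \<bar>g' n x - h' x\<bar> \<le> \<bar>y\<bar> * e"
        by (intro mult_left_mono) (auto simp: dist_real_def less_imp_le)
      then show "norm (y *\<^sub>R g' n x - y *\<^sub>R h' x) \<le> e * norm y"
        by (simp add: abs_mult[symmetric] right_diff_distrib mult.commute)
    qed
  qed (use S t g in auto)
  \<comment> \<open>The limit \<open>k\<close> supplied by the library agrees with \<open>h\<close>
    on \<open>S\<close> by uniqueness of limits, and a derivative within \<open>S\<close> sees no
    more than that.\<close>
  then obtain k where k: "\<And>x. x \<in> S \<Longrightarrow> (\<lambda>n. g n x) \<longlonglongrightarrow> k x"
    "\<And>x. x \<in> S \<Longrightarrow> (k has_vector_derivative h' x) (at x within S)"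
    by (auto simp: has_vector_derivative_def)
  then show ?thesis
    using g LIMSEQ_unique t by (intro has_vector_derivative_transform[OF t _ k(2)[OF t]]) blast
qed

text \<open>An \<open>e/3\<close> argument with a single index \<open>n\<close>. Continuity of the
  limit would not be enough later, since the continuity pieces are not compact.\<close>

lemma uniform_limit_uniformly_continuous_on:
  fixes g :: "nat \<Rightarrow> 'a::metric_space \<Rightarrow> 'b::metric_space"
  assumes lim: "uniform_limit S g h sequentially"
    and uc: "\<And>n. uniformly_continuous_on S (g n)"
  shows "uniformly_continuous_on S h"
  unfolding uniformly_continuous_on_def
proof (intro allI impI)
  fix e :: real assume "0 < e"
  then have "\<forall>\<^sub>F n in sequentially. \<forall>x\<in>S. dist (g n x) (h x) < e/3"
    using uniform_limitD[OF lim, of "e/3"] by simp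
  then obtain n where n: "\<And>x. x \<in> S \<Longrightarrow> dist (g n x) (h x) < e/3"
    using eventually_happens'[OF sequentially_bot] by blast
  obtain d where d: "d > 0" "\<And>x y. x \<in> S \<Longrightarrow> y \<in> S \<Longrightarrow> dist y x < d \<Longrightarrow> dist (g n y) (g n x) < e/3"
    using uc[of n, unfolded uniformly_continuous_on_def, rule_format, of "e/3"] \<open>0 < e\<close> by auto
  have "dist (h y) (h x) < e" if "x \<in> S" "y \<in> S" "dist y x < d" for x y
    using dist_triangle_third[of "h y" "g n y" e "g n x" "h x"] n[OF that(1)] n[OF that(2)] d(2)[OF that]
    by (simp add: dist_commute)
  then show "\<exists>d>0. \<forall>x\<in>S. \<forall>x'\<in>S. dist x' x < d \<longrightarrow> dist (h x') (h x) < e"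
    using d(1) by blast
qed

section \<open>Charts of the continuity pieces\<close>

text \<open>The shape of the \<open>i\<close>-th piece carried over to the unit interval: 0 belongs
  only to the first piece and 1 only to the last. The set does not depend on the map, so that
  different maps can be compared on one domain.\<close>

definition unit_piece :: "nat \<Rightarrow> nat \<Rightarrow> real set" where
  "unit_piece N i = {t. 0 \<le> t \<and> t \<le> 1 \<and> (i = 1 \<or> 0 < t) \<and> (i = N \<or> t < 1)}"

lemma convex_unit_piece: "convex (unit_piece N i)"
proof -
  have "unit_piece N i = (if i = 1 then {0..} else {0<..}) \<inter> (if i = N then {..1} else {..<1})"
    by (auto simp: unit_piece_def)
  then show ?thesis by (simp add: convex_Int)
qed

lemma unit_piece_subset: "unit_piece N i \<subseteq> {0..1}"
  by (auto simp: unit_piece_def)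

lemma half_in_unit_piece: "1/2 \<in> unit_piece N i"
  by (simp add: unit_piece_def)

locale pw_space =
  fixes a b :: real and N r :: nat
  assumes ab: "a < b" and N: "2 \<le> N"
begin

definition separation :: "real set \<Rightarrow> bool" where
  "separation D \<longleftrightarrow> finite D \<and> card D = N - 1 \<and> D \<subseteq> interior {a..b}"

definition len :: "real set \<Rightarrow> nat \<Rightarrow> real" where
  "len D i = bpt a b D i - bpt a b D (i - 1)"

definition chart :: "real set \<Rightarrow> nat \<Rightarrow> real \<Rightarrow> real" where
  "chart D i t = bpt a b D (i - 1) + len D i * t"

lemma len_pos:
  assumes "separation D" "i \<in> {1..N}"
  shows "0 < len D i"
  using assms bpt_strict_mono[of D N a b "i - 1" i] N by (auto simp: separation_def len_def)

lemma bpt_mono: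
  assumes "separation D" "k \<le> l" "l \<le> N"
  shows "bpt a b D k \<le> bpt a b D l"
  using assms bpt_strict_mono[of D N a b k l] N by (cases "k = l") (auto simp: separation_def)

lemma piece_eq:
  assumes "separation D" "i \<in> {1..N}"
  shows "piece a b N D i = {x. bpt a b D (i - 1) \<le> x \<and> x \<le> bpt a b D i \<and>
           (i = 1 \<or> bpt a b D (i - 1) < x) \<and> (i = N \<or> x < bpt a b D i)}"
  using assms N bpt_0[of a b D] bpt_N[of D N a b] by (auto simp: piece_def separation_def)

lemma piece_chart:
  assumes "separation D" "i \<in> {1..N}"
  shows "piece a b N D i = chart D i ` unit_piece N i"
proof -
  have l: "0 < len D i" using len_pos assms by blast
  have "x \<in> chart D i ` unit_piece N i" if "x \<in> piece a b N D i" for x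
  proof
    show "x = chart D i ((x - bpt a b D (i - 1)) / len D i)"
      using l by (simp add: chart_def)
    show "(x - bpt a b D (i - 1)) / len D i \<in> unit_piece N i"
      using that l unfolding piece_eq[OF assms] unit_piece_def
      by (auto simp: divide_simps) (auto simp: len_def)
  qed
  moreover have "chart D i t \<in> piece a b N D i" if "t \<in> unit_piece N i" for t
  proof -
    have "bpt a b D i = bpt a b D (i - 1) + len D i * 1" by (simp add: len_def)
    then show ?thesis
      using that l unfolding piece_eq[OF assms] unit_piece_def chart_def by (auto intro: mult_pos_pos)
  qed
  ultimately show ?thesis by blast
qed

lemma closure_piece_chart:
  assumes "separation D" "i \<in> {1..N}"
  shows "closure (piece a b N D i) = chart D i ` {0..1}"
proof -
  have "chart D i ` {0..1} = {bpt a b D (i - 1)..bpt a b D i}"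
    using image_affinity_atLeastAtMost[of "len D i" "bpt a b D (i - 1)" 0 1] len_pos[OF assms]
    by (simp add: chart_def[abs_def] len_def add.commute)
  then show ?thesis
    using closure_piece[of D N a b i] assms N by (simp add: separation_def)
qed

lemma xi_chart:
  assumes "separation D" "i \<in> {1..N}" "t \<in> {0..1}"
  shows "xi a b D E (chart D i t) = chart E i t"
proof -
  have "chart D i t \<in> closure (piece a b N D i)"
    using assms closure_piece_chart by blast
  then have "xi a b D E (chart D i t) = len E i / len D i * (chart D i t - bpt a b D i) + bpt a b E i"
    using assms N xi_eq[of D N a b i] by (simp add: separation_def len_def)
  \<comment> \<open>The formula for \<open>xi\<close> is anchored at the right end of the piece,
    \<open>chart\<close> at the left end; hence \<open>t - 1\<close>.\<close>
  moreover have "chart D i t - bpt a b D i = len D i * (t - 1)"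
    by (simp add: chart_def len_def algebra_simps)
  ultimately show ?thesis
    using len_pos[OF assms(1,2)] by (simp add: chart_def) (simp add: len_def algebra_simps)
qed

text \<open>The indices 0 and \<open>N\<close> belong to \<open>a\<close> and \<open>b\<close> and
  are left out. This turns equality of break points into equality of separation sets.\<close>

lemma separation_eq_bpt:
  assumes "separation D"
  shows "D = bpt a b D ` {1..N - 1}"
proof -
  have "bpt a b D ` {1..N - 1} = (!) (sorted_list_of_set D) ` {..<N - 1}"
  proof -
    have "bpt a b D (Suc k) = sorted_list_of_set D ! k" if "k < N - 1" for k
      using that assms by (simp add: bpt_def nth_append separation_def)
    moreover have "{1..N - 1} = Suc ` {..<N - 1}"
      by (simp add: image_Suc_lessThan)
    ultimately show ?thesis by (auto simp: image_iff)
  qed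
  also have "\<dots> = set (sorted_list_of_set D)"
    using assms by (auto simp: set_conv_nth separation_def)
  finally show ?thesis using assms by (simp add: separation_def)
qed

text \<open>The converse passage, from break points to a separation set. It will produce the
  separation set of a limit map from the limits of the break points.\<close>

lemma separation_of_bpts:
  assumes c: "c 0 = a" "c N = b" "\<And>i. i < N \<Longrightarrow> c i < c (Suc i)"
  defines "D \<equiv> c ` {1..N - 1}"
  shows "separation D" and "\<And>i. i \<le> N \<Longrightarrow> bpt a b D i = c i"
proof -
  have mono: "c k < c l" if "k < l" "l \<le> N" for k l
    using that
  proof (induction l rule: less_Suc_induct)
    case (1 i) then show ?case using c(3)[of i] by simp
  qed (auto intro: less_trans)
  have inj: "inj_on c {1..N - 1}"
    using mono by (intro linorder_inj_onI') fastforce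
  have "x \<in> interior {a..b}" if "x \<in> D" for x
    using that mono[of 0] mono[of _ N] c N by (auto simp: D_def)
  then show sep: "separation D"
    using card_image[OF inj] by (auto simp: separation_def D_def)
  \<comment> \<open>A strictly sorted list is determined by its set, which identifies
    \<open>sorted_list_of_set D\<close>.\<close>
  have "sorted_wrt (<) (map c [1..<N])"
    using mono by (auto simp: sorted_wrt_iff_nth_less)
  moreover have "set (map c [1..<N]) = D" using N by (auto simp: D_def)
  ultimately have "sorted_list_of_set D = map c [1..<N]"
    by (metis strict_sorted_equal sorted_list_of_set.strict_sorted_key_list_of_set
        sorted_list_of_set.set_sorted_key_list_of_set sep separation_def list.map_ident)
  moreover have "Suc k = N" if "Suc k \<le> N" "\<not> k < N - Suc 0" for k
    using that by simp
  ultimately show "bpt a b D i = c i" if "i \<le> N" for i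
    using that c N by (auto simp: bpt_def nth_append nth_Cons split: nat.split)
qed

section \<open>The pieces partition the interval minus the separation points\<close>

lemma pieces_cover:
  assumes D: "separation D" and x: "x \<in> {a..b} - D"
  shows "\<exists>i\<in>{1..N}. x \<in> piece a b N D i"
proof -
  \<comment> \<open>The first break point not to the left of \<open>x\<close> ends the piece of
    \<open>x\<close>. The condition \<open>1 \<le> i\<close> rules out index 0 for
    \<open>x = a\<close>.\<close>
  define i where "i = (LEAST i. x \<le> bpt a b D i \<and> 1 \<le> i)"
  have bN: "bpt a b D N = b" using D N bpt_N by (simp add: separation_def)
  then have i: "x \<le> bpt a b D i" "1 \<le> i" "i \<le> N"
    using LeastI[of "\<lambda>i. x \<le> bpt a b D i \<and> 1 \<le> i" N] Least_le[of "\<lambda>i. x \<le> bpt a b D i \<and> 1 \<le> i" N] x N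
    by (auto simp: i_def)
  have "i = 1 \<or> bpt a b D (i - 1) < x"
  proof (rule ccontr)
    assume "\<not> ?thesis"
    then have "i \<le> i - 1"
      unfolding i_def using i by (intro Least_le) (auto simp: i_def)
    then show False using i by simp
  qed
  moreover have "i = N \<or> x < bpt a b D i"
  proof -
    have "bpt a b D i \<in> D" if "i \<noteq> N" using separation_eq_bpt[OF D] i that by auto
    then show ?thesis using x i by fastforce
  qed
  moreover have "bpt a b D (i - 1) \<le> x"
    using \<open>i = 1 \<or> _\<close> x bpt_0 by auto
  ultimately show ?thesis using i D by (auto simp: piece_eq)
qed

lemma pieces_disjoint:
  assumes "separation D" "i \<in> {1..N}" "k \<in> {1..N}" "x \<in> piece a b N D i" "x \<in> piece a b N D k"
  shows "i = k"
proof -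
  have "False" if "i < k" "i \<in> {1..N}" "k \<in> {1..N}" "x \<in> piece a b N D i" "x \<in> piece a b N D k" for i k
  proof -
    have "bpt a b D i \<le> bpt a b D (k - 1)"
      using that by (intro bpt_mono[OF assms(1)]) auto
    then show False using that by (auto simp: piece_eq[OF assms(1)])
  qed
  then show ?thesis using assms by (meson linorder_neqE_nat)
qed

end

section \<open>The metric in terms of jets\<close>

lemma closure_unit_piece: "closure (unit_piece N i) = {0..1}"
proof
  show "closure (unit_piece N i) \<subseteq> {0..1}"
    using unit_piece_subset by (simp add: closure_minimal)
  have "{0<..<1} \<subseteq> unit_piece N i" by (auto simp: unit_piece_def)
  then show "{0..1} \<subseteq> closure (unit_piece N i)"
    using closure_mono[of "{0<..<1::real}"] by simp
qed

context pw_space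
begin

lemma pw_maps_separation: "p \<in> pw_maps a b N r \<Longrightarrow> separation (snd p)"
  by (auto simp: pw_maps_def separation_def)

lemma pw_maps_class_C:
  "p \<in> pw_maps a b N r \<Longrightarrow> i \<in> {1..N} \<Longrightarrow> class_C r (fst p) (piece a b N (snd p) i)"
  by (auto simp: pw_maps_def)

lemma pw_maps_uniformly_continuous:
  "p \<in> pw_maps a b N r \<Longrightarrow> i \<in> {1..N} \<Longrightarrow> j \<le> r \<Longrightarrow>
     uniformly_continuous_on (piece a b N (snd p) i)
       (deriv_within (piece a b N (snd p) i) j (fst p))"
  by (auto simp: pw_maps_def)

text \<open>The description \<open>THE\<close> in \<open>ext_deriv\<close> denotes: uniform
  continuity gives an extension, density of \<open>S\<close> in its closure makes it unique there,
  and extensionality fixes it elsewhere.\<close>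

lemma ext_deriv_extends:
  assumes p: "p \<in> pw_maps a b N r" "i \<in> {1..N}" "j \<le> r"
  defines "S \<equiv> piece a b N (snd p) i"
  shows "continuous_on (closure S) (ext_deriv a b N p i j)"
    and "\<And>x. x \<in> S \<Longrightarrow> ext_deriv a b N p i j x = deriv_within S j (fst p) x"
proof -
  let ?P = "\<lambda>h. h \<in> extensional (closure S) \<and> continuous_on (closure S) h \<and>
             (\<forall>x\<in>S. h x = deriv_within S j (fst p) x)"
  obtain g where g: "uniformly_continuous_on (closure S) g"
    "\<And>x. x \<in> S \<Longrightarrow> deriv_within S j (fst p) x = g x"
    using uniformly_continuous_on_extension_on_closure
      pw_maps_uniformly_continuous[OF p] unfolding S_def by metis
  have "continuous_on (closure S) (restrict g (closure S))"
    using uniformly_continuous_imp_continuous[OF g(1)] by (simp cong: continuous_on_cong)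
  then have h: "?P (restrict g (closure S))"
    using g(2) closure_subset[of S] by auto
  have "h = restrict g (closure S)" if "?P h" for h
  proof (rule extensionalityI)
    fix x assume "x \<in> closure S"
    moreover have "continuous_on (closure S) (\<lambda>x. h x - restrict g (closure S) x)"
      using that h by (intro continuous_on_diff) auto
    moreover have "h x - restrict g (closure S) x = 0" if "x \<in> S" for x
      using \<open>?P h\<close> h that by simp
    ultimately have "h x - restrict g (closure S) x = 0"
      by (meson continuous_constant_on_closure)
    then show "h x = restrict g (closure S) x" by simp
  qed (use that in auto)
  with h have "(THE h. ?P h) = restrict g (closure S)"
    by (rule the_equality)
  then have "ext_deriv a b N p i j = restrict g (closure S)"
    by (simp add: ext_deriv_def Let_def S_def)
  then show "continuous_on (closure S) (ext_deriv a b N p i j)"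
    and "\<And>x. x \<in> S \<Longrightarrow> ext_deriv a b N p i j x = deriv_within S j (fst p) x"
    using h by auto
qed

text \<open>
  The derivatives are those with respect to \<open>x\<close>, as in the metric, and not to the chart parameter \<open>t\<close>.
\<close>

definition jet :: "pw_map \<Rightarrow> nat \<Rightarrow> nat \<Rightarrow> real \<Rightarrow> real" where
  "jet p i j t = deriv_within (piece a b N (snd p) i) j (fst p) (chart (snd p) i t)"

definition jet_dist :: "nat \<Rightarrow> nat \<Rightarrow> pw_map \<Rightarrow> pw_map \<Rightarrow> real" where
  "jet_dist i j p q = (SUP x\<in>closure (piece a b N (snd p) i).
     \<bar>ext_deriv a b N p i j x - ext_deriv a b N q i j (xi a b (snd p) (snd q) x)\<bar>)"

lemma comp_rep_eq:
  "comp_rep a b N r p q = (\<Sum>i=1..N-1. \<bar>bpt a b (snd p) i - bpt a b (snd q) i\<bar>) +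
     (\<Sum>i=1..N. \<Sum>j=0..r. jet_dist i j p q)"
  by (simp add: comp_rep_def jet_dist_def)

context
  fixes p q i j
  assumes pq: "p \<in> pw_maps a b N r" "q \<in> pw_maps a b N r" and i: "i \<in> {1..N}" and j: "j \<le> r"
begin

text \<open>Built from the extensions rather than the jets, because it has to be continuous on all
  of \<open>{0..1}\<close>.\<close>

private definition "gap t =
  \<bar>ext_deriv a b N p i j (chart (snd p) i t) - ext_deriv a b N q i j (chart (snd q) i t)\<bar>"

private lemma gap_eq: "t \<in> unit_piece N i \<Longrightarrow> gap t = \<bar>jet p i j t - jet q i j t\<bar>"
  using ext_deriv_extends(2)[OF _ i j] pq piece_chart[OF pw_maps_separation i]
  by (simp add: gap_def jet_def)

private lemma continuous_on_gap: "continuous_on {0..1} gap"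
proof -
  have "continuous_on {0..1} (\<lambda>t. ext_deriv a b N p' i j (chart (snd p') i t))"
    if "p' \<in> pw_maps a b N r" for p'
  proof (rule continuous_on_compose2[OF ext_deriv_extends(1)[OF that i j]])
    show "continuous_on {0..1} (chart (snd p') i)"
      unfolding chart_def by (intro continuous_intros)
  qed (use closure_piece_chart[OF pw_maps_separation i] that in auto)
  then show ?thesis unfolding gap_def using pq by (intro continuous_intros)
qed

private lemma jet_dist_eq: "jet_dist i j p q = (SUP t\<in>{0..1}. gap t)"
proof -
  have "jet_dist i j p q = (SUP t\<in>{0..1}. \<bar>ext_deriv a b N p i j (chart (snd p) i t)
      - ext_deriv a b N q i j (xi a b (snd p) (snd q) (chart (snd p) i t))\<bar>)"
    unfolding jet_dist_def closure_piece_chart[OF pw_maps_separation[OF pq(1)] i]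
    by (simp add: image_image)
  also have "\<dots> = (SUP t\<in>{0..1}. gap t)"
    using xi_chart[OF pw_maps_separation[OF pq(1)] i] by (intro SUP_cong) (auto simp: gap_def)
  finally show ?thesis .
qed

text \<open>Together with \<open>jet_dist_least\<close> this describes \<open>jet_dist\<close> as
  the least upper bound over \<open>unit_piece\<close>; afterwards the extensions
  \<open>ext_deriv\<close> do not appear any more.\<close>

lemma jet_dist_upper:
  assumes "t \<in> unit_piece N i"
  shows "\<bar>jet p i j t - jet q i j t\<bar> \<le> jet_dist i j p q"
proof -
  have "bdd_above (gap ` {0..1})"
    using continuous_on_gap by (intro bounded_imp_bdd_above compact_imp_bounded compact_continuous_image) auto
  then show ?thesis
    using assms unit_piece_subset[of N i] cSUP_upper[of t "{0..1}" gap]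
    by (auto simp: jet_dist_eq gap_eq)
qed

text \<open>A weak bound on \<open>unit_piece\<close> passes to its closure \<open>{0..1}\<close> by
  continuity of \<open>gap\<close>.\<close>

lemma jet_dist_least:
  assumes "\<And>t. t \<in> unit_piece N i \<Longrightarrow> \<bar>jet p i j t - jet q i j t\<bar> \<le> B"
  shows "jet_dist i j p q \<le> B"
  unfolding jet_dist_eq
proof (rule cSUP_least)
  fix t :: real assume "t \<in> {0..1}"
  then show "gap t \<le> B"
    using continuous_on_gap assms
    by (intro continuous_le_on_closure[of "unit_piece N i" gap t]) (simp_all add: closure_unit_piece gap_eq)
qed simp

end

text \<open>The chain rule: the factor \<open>len\<close> is the slope of the chart, since jets hold
  derivatives in \<open>x\<close> while differentiation here is in \<open>t\<close>.\<close>

lemma jet_has_vector_derivative: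
  assumes p: "p \<in> pw_maps a b N r" and i: "i \<in> {1..N}" and j: "j < r" and t: "t \<in> unit_piece N i"
  shows "(jet p i j has_vector_derivative len (snd p) i * jet p i (Suc j) t)
           (at t within unit_piece N i)"
proof -
  define S where "S = piece a b N (snd p) i"
  have S: "S = chart (snd p) i ` unit_piece N i"
    unfolding S_def using piece_chart[OF pw_maps_separation[OF p] i] .
  have "(deriv_within S j (fst p)) differentiable (at (chart (snd p) i t) within S)"
    using pw_maps_class_C[OF p i] j t S unfolding class_C_def S_def differentiable_on_def by auto
  then have "(deriv_within S j (fst p) has_vector_derivative jet p i (Suc j) t)
      (at (chart (snd p) i t) within chart (snd p) i ` unit_piece N i)"
    unfolding vector_derivative_works by (simp add: jet_def S_def[symmetric]) (simp add: S)
  moreover have "(chart (snd p) i has_vector_derivative len (snd p) i) (at t within unit_piece N i)"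
    unfolding chart_def by (auto intro!: derivative_eq_intros)
  ultimately have "((deriv_within S j (fst p) \<circ> chart (snd p) i) has_vector_derivative
      len (snd p) i *\<^sub>R jet p i (Suc j) t) (at t within unit_piece N i)"
    by (intro vector_diff_chain_within)
  then show ?thesis by (simp add: jet_def[abs_def] o_def S_def)
qed

lemma jet_0_mem:
  assumes "p \<in> pw_maps a b N r" "i \<in> {1..N}" "t \<in> unit_piece N i"
  shows "jet p i 0 t \<in> {a..b}"
proof -
  have D: "separation (snd p)" using pw_maps_separation assms by blast
  then have "chart (snd p) i t \<in> piece a b N (snd p) i"
    using piece_chart assms by blast
  also have "\<dots> \<subseteq> {a..b}"
    using piece_avoids[of "snd p" N a b i] D N assms(2) by (auto simp: separation_def)
  finally show ?thesis
    using assms by (auto simp: jet_def pw_maps_def)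
qed

lemma jet_uniformly_continuous:
  assumes p: "p \<in> pw_maps a b N r" and i: "i \<in> {1..N}" and j: "j \<le> r"
  shows "uniformly_continuous_on (unit_piece N i) (jet p i j)"
proof -
  have "uniformly_continuous_on (unit_piece N i) (chart (snd p) i)"
    unfolding chart_def by (intro uniformly_continuous_on_add uniformly_continuous_on_cmul_left
        uniformly_continuous_on_const uniformly_continuous_on_id)
  moreover have "uniformly_continuous_on (chart (snd p) i ` unit_piece N i)
     (deriv_within (piece a b N (snd p) i) j (fst p))"
    using pw_maps_uniformly_continuous[OF p i j] piece_chart[OF pw_maps_separation[OF p] i] by simp
  ultimately show ?thesis
    unfolding jet_def[abs_def] by (rule uniformly_continuous_on_compose)
qed

section \<open>Pseudometric properties of the distance between representatives\<close>

lemma jet_dist_nonneg: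
  assumes "p \<in> pw_maps a b N r" "q \<in> pw_maps a b N r" "i \<in> {1..N}" "j \<le> r"
  shows "0 \<le> jet_dist i j p q"
  using jet_dist_upper[OF assms half_in_unit_piece] by linarith

lemma jet_dist_commute:
  assumes "p \<in> pw_maps a b N r" "q \<in> pw_maps a b N r" "i \<in> {1..N}" "j \<le> r"
  shows "jet_dist i j p q = jet_dist i j q p"
proof (rule antisym)
  show "jet_dist i j p q \<le> jet_dist i j q p"
    using jet_dist_upper[of q p i j] assms by (intro jet_dist_least) (auto simp: abs_minus_commute)
  show "jet_dist i j q p \<le> jet_dist i j p q"
    using jet_dist_upper[of p q i j] assms by (intro jet_dist_least) (auto simp: abs_minus_commute)
qed

lemma jet_dist_triangle:
  assumes "p \<in> pw_maps a b N r" "q \<in> pw_maps a b N r" "s \<in> pw_maps a b N r"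
    and "i \<in> {1..N}" "j \<le> r"
  shows "jet_dist i j p s \<le> jet_dist i j p q + jet_dist i j q s"
proof (rule jet_dist_least)
  fix t assume t: "t \<in> unit_piece N i"
  show "\<bar>jet p i j t - jet s i j t\<bar> \<le> jet_dist i j p q + jet_dist i j q s"
    using jet_dist_upper[OF assms(1,2,4,5) t] jet_dist_upper[OF assms(2,3,4,5) t] by linarith
qed (use assms in auto)

lemma comp_rep_nonneg:
  assumes "p \<in> pw_maps a b N r" "q \<in> pw_maps a b N r"
  shows "0 \<le> comp_rep a b N r p q"
  unfolding comp_rep_eq using jet_dist_nonneg[OF assms] by (intro add_nonneg_nonneg sum_nonneg) auto

lemma comp_rep_commute:
  assumes "p \<in> pw_maps a b N r" "q \<in> pw_maps a b N r"
  shows "comp_rep a b N r p q = comp_rep a b N r q p"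
  unfolding comp_rep_eq using jet_dist_commute[OF assms]
  by (intro arg_cong2[of _ _ _ _ "(+)"] sum.cong) auto

lemma comp_rep_triangle:
  assumes "p \<in> pw_maps a b N r" "q \<in> pw_maps a b N r" "s \<in> pw_maps a b N r"
  shows "comp_rep a b N r p s \<le> comp_rep a b N r p q + comp_rep a b N r q s"
proof -
  have "(\<Sum>i=1..N-1. \<bar>bpt a b (snd p) i - bpt a b (snd s) i\<bar>) \<le>
      (\<Sum>i=1..N-1. \<bar>bpt a b (snd p) i - bpt a b (snd q) i\<bar> +
                    \<bar>bpt a b (snd q) i - bpt a b (snd s) i\<bar>)"
    by (intro sum_mono) linarith
  moreover have "(\<Sum>i=1..N. \<Sum>j=0..r. jet_dist i j p s) \<le>
      (\<Sum>i=1..N. \<Sum>j=0..r. jet_dist i j p q + jet_dist i j q s)"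
    using jet_dist_triangle[OF assms] by (intro sum_mono) auto
  ultimately show ?thesis
    unfolding comp_rep_eq sum.distrib by linarith
qed

lemma jet_dist_le_comp_rep:
  assumes "p \<in> pw_maps a b N r" "q \<in> pw_maps a b N r" "i \<in> {1..N}" "j \<le> r"
  shows "jet_dist i j p q \<le> comp_rep a b N r p q"
proof -
  have "jet_dist i j p q \<le> (\<Sum>j=0..r. jet_dist i j p q)"
    using assms jet_dist_nonneg[OF assms(1,2,3)] by (intro member_le_sum) auto
  also have "\<dots> \<le> (\<Sum>i=1..N. \<Sum>j=0..r. jet_dist i j p q)"
    using assms(3) jet_dist_nonneg[OF assms(1,2)]
    by (intro member_le_sum[where f = "\<lambda>i. \<Sum>j=0..r. jet_dist i j p q"]) (auto intro!: sum_nonneg)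
  finally show ?thesis
    unfolding comp_rep_eq by (simp add: sum_nonneg add_increasing)
qed

lemma bpt_diff_le_comp_rep:
  assumes "p \<in> pw_maps a b N r" "q \<in> pw_maps a b N r" "i \<le> N"
  shows "\<bar>bpt a b (snd p) i - bpt a b (snd q) i\<bar> \<le> comp_rep a b N r p q"
proof (cases "i \<in> {1..N-1}")
  case True
  have "\<bar>bpt a b (snd p) i - bpt a b (snd q) i\<bar> \<le>
      (\<Sum>i=1..N-1. \<bar>bpt a b (snd p) i - bpt a b (snd q) i\<bar>)"
    using True by (intro member_le_sum[where f = "\<lambda>i. \<bar>bpt a b (snd p) i - bpt a b (snd q) i\<bar>"]) auto
  moreover have "0 \<le> (\<Sum>i=1..N. \<Sum>j=0..r. jet_dist i j p q)"
    using jet_dist_nonneg[OF assms(1,2)] by (intro sum_nonneg) auto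
  ultimately show ?thesis unfolding comp_rep_eq by linarith
next
  case False
  \<comment> \<open>The outer break points do not occur in the sum, but they are \<open>a\<close>
    and \<open>b\<close> for both maps.\<close>
  then have "i = 0 \<or> i = N" using assms(3) by auto
  then show ?thesis
    using comp_rep_nonneg[OF assms(1,2)] bpt_0 bpt_N[OF _ N] pw_maps_separation[OF assms(1)]
      pw_maps_separation[OF assms(2)]
    unfolding separation_def by fastforce
qed

text \<open>Distance 0 forces equal break points and then, through the jets of order 0, equal values
  off the separation set. Conversely, pieces avoid the separation set, so related maps have the same
  derivatives within each piece.\<close>

lemma comp_rep_eq_0_iff:
  assumes p: "p \<in> pw_maps a b N r" and q: "q \<in> pw_maps a b N r"
  shows "comp_rep a b N r p q = 0 \<longleftrightarrow> (p, q) \<in> pw_rel a b N r"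
proof
  have sep: "separation (snd p)" "separation (snd q)"
    using pw_maps_separation p q by auto
  assume 0: "comp_rep a b N r p q = 0"
  have "bpt a b (snd p) i = bpt a b (snd q) i" if "i \<le> N" for i
    using bpt_diff_le_comp_rep[OF p q that] unfolding 0 by simp
  then have "bpt a b (snd p) ` {1..N - 1} = bpt a b (snd q) ` {1..N - 1}"
    by (intro image_cong) auto
  then have eq: "snd p = snd q"
    using separation_eq_bpt[OF sep(1)] separation_eq_bpt[OF sep(2)] by argo
  have "fst p x = fst q x" if x: "x \<in> {a..b} - snd p" for x
  proof -
    obtain i t where it: "i \<in> {1..N}" "t \<in> unit_piece N i" "x = chart (snd p) i t"
      using pieces_cover[OF sep(1) x] piece_chart[OF sep(1)] by auto
    then show ?thesis
      using jet_dist_le_comp_rep[OF p q it(1), of 0] jet_dist_upper[OF p q it(1) _ it(2), of 0] 0 eq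
      by (simp add: jet_def)
  qed
  then show "(p, q) \<in> pw_rel a b N r"
    using p q eq unfolding pw_rel_def by (cases p, cases q) auto
next
  assume rel: "(p, q) \<in> pw_rel a b N r"
  then have eq: "snd p = snd q" by (auto simp: pw_rel_def)
  have jet: "jet p i j t = jet q i j t" if i: "i \<in> {1..N}" and t: "t \<in> unit_piece N i" for i j t
  proof -
    have sub: "piece a b N (snd p) i \<subseteq> {a..b} - snd p"
      using piece_avoids[of "snd p" N a b i] pw_maps_separation[OF p] i N
      by (simp add: separation_def)
    moreover have "chart (snd p) i t \<in> piece a b N (snd p) i"
      using piece_chart[OF pw_maps_separation[OF p] i] t by blast
    moreover have "fst p x = fst q x" if "x \<in> {a..b} - snd p" for x
      using rel that by (auto simp: pw_rel_def)
    ultimately show ?thesis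
      unfolding jet_def eq[symmetric] by (intro deriv_within_cong) auto
  qed
  have "jet_dist i j p q = 0" if "i \<in> {1..N}" "j \<le> r" for i j
    using jet that jet_dist_nonneg[OF p q that] by (intro antisym jet_dist_least[OF p q that]) auto
  then show "comp_rep a b N r p q = 0"
    unfolding comp_rep_eq eq by simp
qed

section \<open>Passage to equivalence classes\<close>

definition rep :: "pw_map set \<Rightarrow> pw_map" where
  "rep F = (SOME p. p \<in> F)"

lemma rep_mem:
  assumes "F \<in> PC a b N r"
  shows "rep F \<in> F" "rep F \<in> pw_maps a b N r"
proof -
  obtain p where "p \<in> F"
    using assms in_quotient_imp_non_empty[OF equiv_pw_rel] unfolding PC_def by blast
  then show "rep F \<in> F" unfolding rep_def by (rule someI)
  then show "rep F \<in> pw_maps a b N r"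
    using assms in_quotient_imp_subset[OF equiv_pw_rel] unfolding PC_def by blast
qed

text \<open>\<open>rep\<close> makes the same choice as \<open>comp_dist\<close>, so this holds by
  unfolding, without independence of representatives.\<close>

lemma comp_dist_rep:
  assumes "F \<in> PC a b N r" "G \<in> PC a b N r"
  shows "comp_dist a b N r F G = comp_rep a b N r (rep F) (rep G)"
  using assms by (simp add: comp_dist_def rep_def)

sublocale Metric_space "PC a b N r" "comp_dist a b N r"
proof
  fix F G
  show "0 \<le> comp_dist a b N r F G"
    using comp_rep_nonneg rep_mem(2) comp_dist_rep by (cases "F \<in> PC a b N r \<and> G \<in> PC a b N r")
      (auto simp: comp_dist_def)
  show "comp_dist a b N r F G = comp_dist a b N r G F"
    using comp_rep_commute rep_mem(2) comp_dist_rep by (cases "F \<in> PC a b N r \<and> G \<in> PC a b N r")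
      (auto simp: comp_dist_def)
next
  fix F G assume FG: "F \<in> PC a b N r" "G \<in> PC a b N r"
  then show "(comp_dist a b N r F G = 0) = (F = G)"
    using comp_rep_eq_0_iff[OF rep_mem(2) rep_mem(2), OF FG]
      quotient_eq_iff[OF equiv_pw_rel, of F a b N r G "rep F" "rep G"] rep_mem(1)
    by (simp add: comp_dist_rep PC_def)
next
  fix F G H assume "F \<in> PC a b N r" "G \<in> PC a b N r" "H \<in> PC a b N r"
  then show "comp_dist a b N r F H \<le> comp_dist a b N r F G + comp_dist a b N r G H"
    by (simp add: comp_dist_rep comp_rep_triangle rep_mem(2))
qed

end

section \<open>Limits of Cauchy sequences\<close>

context pw_space
begin

text \<open>A connected set with more than one point has no isolated points. This makes derivatives
  within a piece unique, so that \<open>deriv_within\<close> can be evaluated.\<close>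

lemma at_within_piece:
  assumes "separation D" "i \<in> {1..N}" "x \<in> piece a b N D i"
  shows "at x within piece a b N D i \<noteq> bot"
proof -
  let ?P = "piece a b N D i"
  have P: "?P = chart D i ` unit_piece N i" using piece_chart assms by blast
  have "continuous_on (unit_piece N i) (chart D i)"
    unfolding chart_def by (intro continuous_intros)
  then have "connected ?P"
    unfolding P using convex_connected[OF convex_unit_piece] by (rule connected_continuous_image)
  moreover have "\<nexists>y. ?P = {y}"
  proof
    assume "\<exists>y. ?P = {y}"
    moreover have "chart D i (1/2) \<in> ?P" "chart D i (1/3) \<in> ?P"
      unfolding P by (auto simp: unit_piece_def)
    ultimately have "chart D i (1/2) = chart D i (1/3)" by auto
    then show False using len_pos[OF assms(1,2)] by (simp add: chart_def)
  qed
  ultimately have "x islimpt ?P" using assms(3) connected_imp_perfect by blast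
  then show ?thesis by (simp add: trivial_limit_within)
qed

text \<open>The functions \<open>v i 0\<close> are transported by the inverse charts and glued. The
  factor \<open>len D i\<close> in \<open>der\<close> is exactly what makes the transported
  \<open>v i j\<close> the derivatives of order \<open>j\<close> in \<open>x\<close>.\<close>

lemma pw_map_of_jets:
  assumes D: "separation D"
    and mem: "\<And>i t. i \<in> {1..N} \<Longrightarrow> t \<in> unit_piece N i \<Longrightarrow> v i 0 t \<in> {a..b}"
    and der: "\<And>i j t. i \<in> {1..N} \<Longrightarrow> j < r \<Longrightarrow> t \<in> unit_piece N i \<Longrightarrow>
       (v i j has_vector_derivative len D i * v i (Suc j) t) (at t within unit_piece N i)"
    and uc: "\<And>i j. i \<in> {1..N} \<Longrightarrow> j \<le> r \<Longrightarrow> uniformly_continuous_on (unit_piece N i) (v i j)"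
  obtains f where "(f, D) \<in> pw_maps a b N r"
    and "\<And>i j t. i \<in> {1..N} \<Longrightarrow> j \<le> r \<Longrightarrow> t \<in> unit_piece N i \<Longrightarrow> jet (f, D) i j t = v i j t"
proof -
  \<comment> \<open>\<open>\<tau> i\<close> inverts \<open>chart D i\<close>, and \<open>idx\<close>
    finds the piece of a point. On \<open>D\<close> the value \<open>a\<close> is an arbitrary
    choice inside the interval, as classes ignore values there; \<open>undefined\<close> outside is
    dictated by \<open>\<rightarrow>\<^sub>E\<close>.\<close>
  define \<tau> where "\<tau> i x = (x - bpt a b D (i - 1)) / len D i" for i x
  define idx where "idx x = (SOME i. i \<in> {1..N} \<and> x \<in> piece a b N D i)" for x
  define f where "f x = (if x \<in> {a..b} then if x \<in> D then a else v (idx x) 0 (\<tau> (idx x) x) else undefined)" for x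
  have \<tau>_chart: "\<tau> i (chart D i t) = t" if "i \<in> {1..N}" for i t
    using len_pos[OF D that] by (simp add: \<tau>_def chart_def)
  have idx: "idx x = i" if "i \<in> {1..N}" "x \<in> piece a b N D i" for i x
    unfolding idx_def using that pieces_disjoint[OF D] by (intro some_equality) auto
  have P: "piece a b N D i = chart D i ` unit_piece N i" if "i \<in> {1..N}" for i
    using piece_chart[OF D that] .
  have sub: "piece a b N D i \<subseteq> {a..b} - D" if "i \<in> {1..N}" for i
    using piece_avoids[of D N a b i] D that N by (simp add: separation_def)
  have \<tau>_mem: "\<tau> i x \<in> unit_piece N i" if "i \<in> {1..N}" "x \<in> piece a b N D i" for i x
    using that(2) \<tau>_chart[OF that(1)] unfolding P[OF that(1)] by auto
  have \<tau>_image: "\<tau> i ` piece a b N D i = unit_piece N i" if "i \<in> {1..N}" for i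
    unfolding P[OF that] by (simp add: image_image \<tau>_chart[OF that])
  have f_piece: "f x = v i 0 (\<tau> i x)" if "i \<in> {1..N}" "x \<in> piece a b N D i" for i x
    using sub[OF that(1)] that(2) idx[OF that] by (auto simp: f_def)
  have v_der: "((\<lambda>x. v i j (\<tau> i x)) has_vector_derivative v i (Suc j) (\<tau> i x)) (at x within piece a b N D i)"
    if "i \<in> {1..N}" "j < r" "x \<in> piece a b N D i" for i j x
  proof -
    have "(\<tau> i has_vector_derivative 1 / len D i) (at x within piece a b N D i)"
      unfolding \<tau>_def using len_pos[OF D that(1)]
      by (auto intro!: derivative_eq_intros simp: has_real_derivative_iff_has_vector_derivative[symmetric])
    moreover have "(v i j has_vector_derivative len D i * v i (Suc j) (\<tau> i x))
        (at (\<tau> i x) within \<tau> i ` piece a b N D i)"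
      unfolding \<tau>_image[OF that(1)] using der[OF that(1,2) \<tau>_mem[OF that(1,3)]] .
    ultimately have "((v i j \<circ> \<tau> i) has_vector_derivative
        (1 / len D i) *\<^sub>R (len D i * v i (Suc j) (\<tau> i x))) (at x within piece a b N D i)"
      by (rule vector_diff_chain_within)
    then show ?thesis using len_pos[OF D that(1)] by (simp add: o_def)
  qed
  have deriv: "deriv_within (piece a b N D i) j f x = v i j (\<tau> i x)"
    if "i \<in> {1..N}" "j \<le> r" "x \<in> piece a b N D i" for i j x
    using that(2,3)
  proof (induction j arbitrary: x)
    case 0
    then show ?case using f_piece that(1) by simp
  next
    case (Suc j)
    have "(deriv_within (piece a b N D i) j f has_vector_derivative v i (Suc j) (\<tau> i x))
        (at x within piece a b N D i)"
    \<comment> \<open>The induction hypothesis gives agreement with the transported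
      \<open>v i j\<close> on the piece only, which suffices for the derivative within it.\<close>
    proof (rule has_vector_derivative_transform[OF Suc.prems(2)])
      show "((\<lambda>x. v i j (\<tau> i x)) has_vector_derivative v i (Suc j) (\<tau> i x)) (at x within piece a b N D i)"
        using Suc.prems by (intro v_der that) simp_all
    qed (use Suc in simp)
    then show ?case
      using vector_derivative_within[OF at_within_piece[OF D that(1) Suc.prems(2)]] by simp
  qed
  have dwithin: "(deriv_within (piece a b N D i) j f has_vector_derivative v i (Suc j) (\<tau> i x))
      (at x within piece a b N D i)"
    if "i \<in> {1..N}" "j < r" "x \<in> piece a b N D i" for i j x
    by (rule has_vector_derivative_transform[OF that(3) _ v_der[OF that]]) (use that deriv in simp)
  have uc_deriv: "uniformly_continuous_on (piece a b N D i) (deriv_within (piece a b N D i) j f)"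
    if "i \<in> {1..N}" "j \<le> r" for i j
  proof -
    have "uniformly_continuous_on (piece a b N D i) (\<lambda>x. (1 / len D i) * (x - bpt a b D (i - 1)))"
      by (intro uniformly_continuous_on_cmul_left uniformly_continuous_on_diff
          uniformly_continuous_on_const uniformly_continuous_on_id)
    then have "uniformly_continuous_on (piece a b N D i) (\<tau> i)"
      by (simp add: \<tau>_def[abs_def])
    moreover have "uniformly_continuous_on (\<tau> i ` piece a b N D i) (v i j)"
      using uc[OF that] \<tau>_image[OF that(1)] by simp
    ultimately have "uniformly_continuous_on (piece a b N D i) (\<lambda>x. v i j (\<tau> i x))"
      by (rule uniformly_continuous_on_compose)
    then show ?thesis
      using deriv[OF that] unfolding uniformly_continuous_on_def by simp
  qed
  have "f x \<in> {a..b}" if x: "x \<in> {a..b}" for x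
  proof (cases "x \<in> D")
    case False
    then obtain i where i: "i \<in> {1..N}" "x \<in> piece a b N D i"
      using pieces_cover[OF D] x by blast
    then show ?thesis using mem \<tau>_mem f_piece by simp
  qed (use x ab in \<open>auto simp: f_def\<close>)
  then have "f \<in> {a..b} \<rightarrow>\<^sub>E {a..b}"
    by (intro PiE_I) (auto simp: f_def)
  moreover have "class_C r f (piece a b N D i)" if "i \<in> {1..N}" for i
    unfolding class_C_def differentiable_on_def
    using differentiableI_vector[OF dwithin[OF that]]
      uniformly_continuous_imp_continuous[OF uc_deriv[OF that]] by simp
  ultimately have "(f, D) \<in> pw_maps a b N r"
    using D uc_deriv unfolding pw_maps_def separation_def by simp
  moreover have "jet (f, D) i j t = v i j t" if "i \<in> {1..N}" "j \<le> r" "t \<in> unit_piece N i" for i j t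
    using that deriv[OF that(1,2), of "chart D i t"] P[OF that(1)] \<tau>_chart[OF that(1)]
    by (auto simp: jet_def)
  ultimately show thesis by (rule that)
qed

section \<open>The gauge: minimal length of a piece\<close>

definition min_len :: "pw_map set \<Rightarrow> real" where
  "min_len F = Min (len (snd (rep F)) ` {1..N})"

lemma min_len_pos: "F \<in> PC a b N r \<Longrightarrow> 0 < min_len F"
  unfolding min_len_def using N len_pos[OF pw_maps_separation[OF rep_mem(2)]]
  by (subst Min_gr_iff) auto

lemma min_len_le: "i \<in> {1..N} \<Longrightarrow> min_len F \<le> len (snd (rep F)) i"
  unfolding min_len_def by (intro Min_le) auto

text \<open>The lengths are compared at an index where the minimum for \<open>G\<close> is attained.
  A length is a difference of two break points, each of which moves by at most the distance; hence
  the factor 2.\<close>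

lemma min_len_diff:
  assumes "F \<in> PC a b N r" "G \<in> PC a b N r"
  shows "min_len F \<le> min_len G + 2 * comp_dist a b N r F G"
proof -
  have "min_len G \<in> len (snd (rep G)) ` {1..N}"
    unfolding min_len_def using N by (intro Min_in) auto
  then obtain i where i: "i \<in> {1..N}" "min_len G = len (snd (rep G)) i" by blast
  have "\<bar>bpt a b (snd (rep F)) k - bpt a b (snd (rep G)) k\<bar> \<le> comp_dist a b N r F G" if "k \<le> N" for k
    using bpt_diff_le_comp_rep[OF rep_mem(2) rep_mem(2) that] assms comp_dist_rep by simp
  from this[of i] this[of "i - 1"] i(1)
  have "\<bar>bpt a b (snd (rep F)) i - bpt a b (snd (rep G)) i\<bar> \<le> comp_dist a b N r F G"
    "\<bar>bpt a b (snd (rep F)) (i - 1) - bpt a b (snd (rep G)) (i - 1)\<bar> \<le> comp_dist a b N r F G"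
    by auto
  then have "len (snd (rep F)) i \<le> len (snd (rep G)) i + 2 * comp_dist a b N r F G"
    unfolding len_def by linarith
  then show ?thesis using min_len_le[OF i(1), of F] i(2) by linarith
qed

text \<open>By symmetry of the distance, \<open>min_len_diff\<close> makes \<open>min_len\<close>
  Lipschitz with constant 2.\<close>

lemma continuous_map_min_len: "continuous_map mtopology euclideanreal min_len"
proof -
  have "\<bar>min_len F - min_len G\<bar> \<le> 2 * comp_dist a b N r F G"
    if "F \<in> PC a b N r" "G \<in> PC a b N r" for F G
    using min_len_diff[OF that] min_len_diff[OF that(2,1)] commute[of F G] by linarith
  then have "\<exists>d>0. \<forall>G. G \<in> PC a b N r \<and> comp_dist a b N r F G < d \<longrightarrow> dist (min_len F) (min_len G) < e"
    if "F \<in> PC a b N r" "0 < e" for F e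
    using that by (intro exI[of _ "e/2"]) (fastforce simp: dist_real_def)
  then show ?thesis
    using metric_continuous_map[OF Met_TC.Metric_space_axioms, of min_len] by simp
qed

text \<open>Break points converge in the reals and jets converge uniformly on the fixed sets
  \<open>unit_piece\<close>; \<open>pw_map_of_jets\<close> assembles the limits into a map.\<close>

lemma MCauchy_limit:
  assumes \<sigma>: "MCauchy \<sigma>" and \<delta>: "0 < \<delta>" "\<And>n. \<delta> \<le> min_len (\<sigma> n)"
  shows "\<exists>F. limitin mtopology \<sigma> F sequentially"
proof -
  define p where "p n = rep (\<sigma> n)" for n
  have \<sigma>_mem: "\<sigma> n \<in> PC a b N r" for n using \<sigma> unfolding MCauchy_def by blast
  have p: "p n \<in> pw_maps a b N r" for n unfolding p_def using rep_mem(2) \<sigma>_mem by blast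
  have dist_p: "comp_dist a b N r (\<sigma> m) (\<sigma> n) = comp_rep a b N r (p m) (p n)" for m n
    unfolding p_def using comp_dist_rep \<sigma>_mem by blast
  have Cau: "\<exists>M. \<forall>m n. M \<le> m \<longrightarrow> M \<le> n \<longrightarrow> comp_rep a b N r (p m) (p n) < e" if "e > 0" for e
    using \<sigma>[unfolded MCauchy_def dist_p] that by simp
  define c where "c i = lim (\<lambda>n. bpt a b (snd (p n)) i)" for i
  have c: "(\<lambda>n. bpt a b (snd (p n)) i) \<longlonglongrightarrow> c i" if "i \<le> N" for i
  proof -
    have "Cauchy (\<lambda>n. bpt a b (snd (p n)) i)"
    proof (rule metric_CauchyI)
      fix e :: real assume "0 < e"
      then obtain M where M: "\<And>m n. m \<ge> M \<Longrightarrow> n \<ge> M \<Longrightarrow> comp_rep a b N r (p m) (p n) < e"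
        using Cau by metis
      have *: "\<bar>bpt a b (snd (p m)) i - bpt a b (snd (p n)) i\<bar> < e" if "m \<ge> M" "n \<ge> M" for m n
        using le_less_trans[OF bpt_diff_le_comp_rep[OF p p \<open>i \<le> N\<close>] M[OF that]] .
      show "\<exists>M. \<forall>m\<ge>M. \<forall>n\<ge>M. dist (bpt a b (snd (p m)) i) (bpt a b (snd (p n)) i) < e"
        unfolding dist_real_def using * by blast
    qed
    then show ?thesis unfolding c_def by (simp add: Cauchy_convergent_iff convergent_LIMSEQ_iff)
  qed
  have len_lim: "(\<lambda>n. len (snd (p n)) i) \<longlonglongrightarrow> c i - c (i - 1)" if "i \<in> {1..N}" for i
    unfolding len_def using that by (intro tendsto_diff c) auto
  \<comment> \<open>The lower bound \<open>\<delta>\<close> enters here: it survives in the limit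
    and keeps the separation points from merging.\<close>
  have "c i < c (Suc i)" if "i < N" for i
  proof -
    have "\<delta> \<le> len (snd (p n)) (Suc i)" for n
      using \<delta>(2)[of n] min_len_le[of "Suc i" "\<sigma> n"] that unfolding p_def by simp
    then have "\<delta> \<le> c (Suc i) - c (Suc i - 1)"
      using that by (intro LIMSEQ_le_const[OF len_lim]) auto
    then show ?thesis using \<delta>(1) by simp
  qed
  moreover have "c 0 = a" by (simp add: c_def bpt_0)
  moreover have "c N = b"
    using bpt_N[OF _ N] pw_maps_separation[OF p] by (simp add: c_def separation_def)
  ultimately obtain D where D: "separation D" and bpt_D: "\<And>i. i \<le> N \<Longrightarrow> bpt a b D i = c i"
    using separation_of_bpts[of c] by metis
  have len_D: "(\<lambda>n. len (snd (p n)) i) \<longlonglongrightarrow> len D i" if "i \<in> {1..N}" for i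
    using len_lim[OF that] that bpt_D[of i] bpt_D[of "i - 1"] by (simp add: len_def le_diff_conv)
  define v where "v i j t = lim (\<lambda>n. jet (p n) i j t)" for i j t
  have v: "uniform_limit (unit_piece N i) (\<lambda>n. jet (p n) i j) (v i j) sequentially"
    if i: "i \<in> {1..N}" and j: "j \<le> r" for i j
  proof -
    have "uniformly_Cauchy_on (unit_piece N i) (\<lambda>n. jet (p n) i j)"
    proof (rule uniformly_Cauchy_onI)
      fix e :: real assume "0 < e"
      then obtain M where M: "\<And>m n. m \<ge> M \<Longrightarrow> n \<ge> M \<Longrightarrow> comp_rep a b N r (p m) (p n) < e"
        using Cau by metis
      \<comment> \<open>The bound does not involve \<open>t\<close>, so the Cauchy property of the
        sequence is uniform on \<open>unit_piece\<close>.\<close>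
      have *: "dist (jet (p m) i j t) (jet (p n) i j t) \<le> comp_rep a b N r (p m) (p n)"
        if "t \<in> unit_piece N i" for m n t
        using jet_dist_upper[OF p p i j that] jet_dist_le_comp_rep[OF p p i j] order_trans
        unfolding dist_real_def by blast
      have **: "dist (jet (p m) i j t) (jet (p n) i j t) < e"
        if "t \<in> unit_piece N i" "m \<ge> M" "n \<ge> M" for m n t
        using le_less_trans[OF *[OF that(1)] M[OF that(2,3)]] .
      show "\<exists>M. \<forall>t\<in>unit_piece N i. \<forall>m\<ge>M. \<forall>n\<ge>M. dist (jet (p m) i j t) (jet (p n) i j t) < e"
        using ** by blast
    qed
    then have "uniformly_convergent_on (unit_piece N i) (\<lambda>n. jet (p n) i j)"
      by (rule Cauchy_uniformly_convergent)
    then show ?thesis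
      by (simp add: uniformly_convergent_uniform_limit_iff v_def[abs_def])
  qed
  have v_uc: "uniformly_continuous_on (unit_piece N i) (v i j)" if "i \<in> {1..N}" "j \<le> r" for i j
    using uniform_limit_uniformly_continuous_on[OF v jet_uniformly_continuous] that p by blast
  have v_mem: "v i 0 t \<in> {a..b}" if "i \<in> {1..N}" "t \<in> unit_piece N i" for i t
    using Lim_in_closed_set[OF closed_atLeastAtMost _ _ tendsto_uniform_limitI[OF v[OF that(1)] that(2)], of 0 a b]
      jet_0_mem[OF p that] by simp
  have v_der: "(v i j has_vector_derivative len D i * v i (Suc j) t) (at t within unit_piece N i)"
    if i: "i \<in> {1..N}" and j: "j < r" and t: "t \<in> unit_piece N i" for i j t
  proof (rule uniform_limit_has_vector_derivative[OF convex_unit_piece _ _ _ t])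
    show "(jet (p n) i j has_vector_derivative len (snd (p n)) i * jet (p n) i (Suc j) t)
        (at t within unit_piece N i)" if "t \<in> unit_piece N i" for n t
      using jet_has_vector_derivative[OF p i j that] .
    show "(\<lambda>n. jet (p n) i j t) \<longlonglongrightarrow> v i j t" if "t \<in> unit_piece N i" for t
      using tendsto_uniform_limitI[OF v[OF i] that] j by simp
    show "uniform_limit (unit_piece N i) (\<lambda>n t. len (snd (p n)) i * jet (p n) i (Suc j) t)
        (\<lambda>t. len D i * v i (Suc j) t) sequentially"
    \<comment> \<open>The slopes vary with \<open>n\<close>, so a product has to converge uniformly.
      This needs bounded limits; \<open>v i (Suc j)\<close> is bounded as a uniformly continuous
      function on a bounded set.\<close>
    proof (rule uniform_lim_mult)
      show "uniform_limit (unit_piece N i) (\<lambda>n t. len (snd (p n)) i) (\<lambda>t. len D i) sequentially"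
        using len_D[OF i] by (auto simp: uniform_limit_iff tendsto_iff)
      show "uniform_limit (unit_piece N i) (\<lambda>n. jet (p n) i (Suc j)) (v i (Suc j)) sequentially"
        using v i j by simp
      show "bounded (v i (Suc j) ` unit_piece N i)"
        using v_uc[OF i, of "Suc j"] j bounded_subset[OF _ unit_piece_subset]
        by (intro bounded_uniformly_continuous_image) auto
    qed (auto intro: bounded_subset[of "{len D i}"])
  qed
  obtain f where f: "(f, D) \<in> pw_maps a b N r"
    and jet_f: "\<And>i j t. i \<in> {1..N} \<Longrightarrow> j \<le> r \<Longrightarrow> t \<in> unit_piece N i \<Longrightarrow> jet (f, D) i j t = v i j t"
    using pw_map_of_jets[of D v, OF D v_mem v_der v_uc] by blast
  define F where "F = pw_rel a b N r `` {(f, D)}"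
  have F: "F \<in> PC a b N r" "(f, D) \<in> F"
    unfolding F_def PC_def using f equiv_class_self[OF equiv_pw_rel] by (auto intro: quotientI)
  have jet_lim: "(\<lambda>n. jet_dist i j (p n) (f, D)) \<longlonglongrightarrow> 0" if i: "i \<in> {1..N}" and j: "j \<le> r" for i j
  proof (rule LIMSEQ_I)
    fix e :: real assume "0 < e"
    then have "\<forall>\<^sub>F n in sequentially. \<forall>t\<in>unit_piece N i. dist (jet (p n) i j t) (v i j t) < e/2"
      using uniform_limitD[OF v[OF i j], of "e/2"] by simp
    then obtain M where M: "\<And>n t. n \<ge> M \<Longrightarrow> t \<in> unit_piece N i \<Longrightarrow> dist (jet (p n) i j t) (v i j t) < e/2"
      unfolding eventually_sequentially by blast
    have "norm (jet_dist i j (p n) (f, D) - 0) < e" if n: "n \<ge> M" for n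
    proof -
      \<comment> \<open>A supremum preserves only weak inequalities; \<open>e/2\<close> leaves room
        for the strict one.\<close>
      have "jet_dist i j (p n) (f, D) \<le> e/2"
        using M[OF n] jet_f[OF i j]
        by (intro jet_dist_least[OF p f i j]) (simp add: dist_real_def less_imp_le)
      then show ?thesis
        using jet_dist_nonneg[OF p[of n] f i j] \<open>0 < e\<close> by simp
    qed
    then show "\<exists>M. \<forall>n\<ge>M. norm (jet_dist i j (p n) (f, D) - 0) < e" by blast
  qed
  have "(\<lambda>n. \<bar>bpt a b (snd (p n)) i - bpt a b D i\<bar>) \<longlonglongrightarrow> 0" if "i \<le> N" for i
    using c[OF that] bpt_D[OF that] by (simp add: tendsto_rabs_zero_iff LIM_zero)
  then have "(\<lambda>n. comp_rep a b N r (p n) (f, D)) \<longlonglongrightarrow> 0"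
    unfolding comp_rep_eq using jet_lim
    by (intro tendsto_add_zero tendsto_null_sum) auto
  \<comment> \<open>The chosen representative of \<open>F\<close> may differ from
    \<open>(f, D)\<close>, so independence of representatives is used.\<close>
  moreover have "comp_dist a b N r (\<sigma> n) F = comp_rep a b N r (p n) (f, D)" for n
    unfolding p_def using comp_dist_eq[OF N \<sigma>_mem rep_mem(1)[OF \<sigma>_mem] F] .
  ultimately have "limitin mtopology \<sigma> F sequentially"
    unfolding limitin_metric_dist_null using F(1) \<sigma>_mem by simp
  then show ?thesis ..
qed

end

theorem theorem1p1:
  fixes a b :: real and N r :: nat
  assumes "a < b" and "2 \<le> N"
  shows "Metric_space (PC a b N r) (comp_dist a b N r) \<and>
         Baire_space (Metric_space.mtopology (PC a b N r) (comp_dist a b N r))"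
proof -
  interpret pw_space a b N r
    using assms by unfold_locales
  \<comment> \<open>The gauge \<open>\<phi>\<close> is \<open>min_len\<close>; the three facts
    discharge \<open>cont\<close>, \<open>pos\<close> and \<open>lim\<close> in this order.\<close>
  have "completely_metrizable_space mtopology"
    using continuous_map_min_len min_len_pos MCauchy_limit by (rule completely_metrizable_by_gauge)
  then show ?thesis
    using Metric_space_axioms completely_metrizable_imp_Baire_space by blast
qed

end
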